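(* Let $X\sim\Gamma(1,1)$ and let $p,q$ be real numbers. For every integer $n\ge 0$, $$E\bigg[\frac{(X-1+p+iq)^{n}-(X-1+p-iq)^{n}}{2i}\bigg]=D_{n}^{(s)}(p,q).$$
   Context: Here $i=\sqrt{-1}$. $X\sim\Gamma(1,1)$ means that $X$ is a gamma random variable with parameters $\alpha=1,\lambda=1$, i.e. a real random variable with density $f(x)=e^{-x}$ for $x\ge 0$ and $f(x)=0$ for $x<0$; $E$ denotes expectation. The sine-derangement polynomials $D_n^{(s)}(x,y)$, $n\ge 0$, are defined by the generating function (power series in $t$) $\displaystyle\frac{e^{-t}}{1-t}e^{xt}\sin(yt)=\sum_{n=0}^{\infty}D_{n}^{(s)}(x,y)\frac{t^{n}}{n!}$. *)

theory Defs
  imports "HOL-Probability.Probability" "HOL-Computational_Algebra.Computational_Algebra"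
begin

definition sine_derangement_gf :: "real \<Rightarrow> real \<Rightarrow> real fps" where
  "sine_derangement_gf x y = fps_exp (- 1) / (1 - fps_X) * fps_exp x * fps_sin y"

definition sine_derangement :: "nat \<Rightarrow> real \<Rightarrow> real \<Rightarrow> real" where
  "sine_derangement n x y = fact n * fps_nth (sine_derangement_gf x y) n"

(* Gamma with alpha = lambda = 1 is the exponential distribution of rate 1, so
   the library's exponential_density 1 is exactly exp (- x) for x >= 0 and 0 for x < 0. *)
definition gamma_1_1_distributed :: "'a measure \<Rightarrow> ('a \<Rightarrow> real) \<Rightarrow> bool" where
  "gamma_1_1_distributed M X \<longleftrightarrow> distributed M lborel X (exponential_density 1)"

end

theory Submission
  imports Defs
begin

text \<open>
  Both sides are \<open>n!\<close> times a partial sum of the same series. Since the \<open>k\<close>-th moment of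
  \<open>X\<close> is \<open>k!\<close>, the factorials in the binomial expansion of \<open>(X + c)^n\<close> cancel against those in
  the binomial coefficients, and its expectation is \<open>n!\<close> times the exponential series of \<open>c\<close>
  cut off after degree \<open>n\<close> (\<open>has_bochner_integral_exponential_shift_power\<close>). With
  \<open>c = p - 1 \<plusminus> i q\<close> the difference of the two expectations, divided by \<open>2i\<close>, collects the
  coefficients of \<open>(exp ((p - 1 + i q) t) - exp ((p - 1 - i q) t)) / (2i)\<close> up to degree \<open>n\<close>;
  by Euler's formula this series is \<open>exp ((p - 1) t) sin (q t)\<close>
  (\<open>of_real_nth_fps_exp_mult_fps_sin\<close>). On the other side, the factor \<open>1 / (1 - t)\<close> of the
  generating function sums exactly these coefficients (\<open>sine_derangement_eq_sum\<close>).
\<close>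

text \<open>
  The moments enter through \<open>(n choose k) * k! = n! / (n - k)!\<close>. The shift \<open>c\<close> is complex so that
  one statement covers both conjugate powers in the theorem, and the Bochner form yields
  integrability and the value together.
\<close>
lemma has_bochner_integral_exponential_shift_power:
  fixes X :: "'a \<Rightarrow> real" and c :: complex
  assumes "prob_space M" and D: "distributed M lborel X (exponential_density 1)"
  shows "has_bochner_integral M (\<lambda>\<omega>. (complex_of_real (X \<omega>) + c) ^ n)
           (fact n * (\<Sum>j\<le>n. c ^ j / fact j))"
proof -
  interpret prob_space M by fact
  have moment: "has_bochner_integral M (\<lambda>\<omega>. complex_of_real (X \<omega>) ^ k) (fact k)" for k
    using has_bochner_integral_of_real[OF has_bochner_integral_erlang_ith_moment[OF _ D, of k],
        where 'a = complex]
    by simp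
  have "has_bochner_integral M
          (\<lambda>\<omega>. \<Sum>k\<le>n. of_nat (n choose k) * complex_of_real (X \<omega>) ^ k * c ^ (n - k))
          (\<Sum>k\<le>n. of_nat (n choose k) * fact k * c ^ (n - k))"
    by (intro has_bochner_integral_sum has_bochner_integral_mult_left
          has_bochner_integral_mult_right moment)
  moreover have "(\<Sum>k\<le>n. of_nat (n choose k) * fact k * c ^ (n - k))
      = fact n * (\<Sum>j\<le>n. c ^ j / fact j)"
  proof -
    have "(\<Sum>k\<le>n. of_nat (n choose k) * fact k * c ^ (n - k))
        = (\<Sum>k\<le>n. fact n * (c ^ (n - k) / fact (n - k)))"
      by (intro sum.cong refl) (simp add: binomial_fact field_simps)
    also have "\<dots> = (\<Sum>j\<le>n. fact n * (c ^ j / fact j))"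
      by (rule sum.reindex_bij_witness[where i = "\<lambda>j. n - j" and j = "\<lambda>k. n - k"]) auto
    finally show ?thesis by (simp add: sum_distrib_left)
  qed
  ultimately show ?thesis by (simp add: binomial_ring)
qed

text \<open>
  Euler's formula, read off coefficient by coefficient. The series on the left is real, so its
  coefficients are first embedded in the complex numbers, where the sine splits into exponentials.
\<close>
lemma of_real_nth_fps_exp_mult_fps_sin:
  "complex_of_real (fps_nth (fps_exp a * fps_sin b) m)
     = ((of_real a + \<i> * of_real b) ^ m / fact m - (of_real a - \<i> * of_real b) ^ m / fact m)
         / (2 * \<i>)"
proof -
  have "complex_of_real (fps_nth (fps_exp a * fps_sin b) m)
      = fps_nth (fps_exp (of_real a) * fps_sin (of_real b)) m"
    by (simp add: fps_mult_nth fps_sin_def if_distrib cong: if_cong)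
  also have "fps_sin (complex_of_real b)
      = fps_const (inverse (2 * \<i>)) *
          (fps_exp (\<i> * of_real b) - fps_exp (- \<i> * of_real b))"
    by (subst fps_sin_fps_exp_ii) (simp add: fps_divide_unit fps_const_inverse mult.commute)
  also have "fps_exp (of_real a) * \<dots>
      = fps_const (inverse (2 * \<i>)) *
          (fps_exp (of_real a + \<i> * of_real b) - fps_exp (of_real a - \<i> * of_real b))"
    by (simp only: fps_exp_add_mult right_diff_distrib mult.left_commute
          diff_conv_add_uminus[of "of_real a"] mult_minus_left)
  finally show ?thesis
    by (simp only: fps_mult_left_const_nth fps_sub_nth fps_exp_nth of_nat_fact
          divide_inverse mult.commute)
qed

text \<open>
  The factors \<open>exp (- t)\<close> and \<open>exp (p t)\<close> merge, which is where the shift of \<open>X\<close> by \<open>-1\<close> comes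
  from; division by \<open>1 - t\<close> takes partial sums of coefficients.
\<close>
lemma sine_derangement_eq_sum:
  "sine_derangement n p q
     = fact n * (\<Sum>j\<le>n. fps_nth (fps_exp (p - 1) * fps_sin q) j)"
proof -
  have "sine_derangement_gf p q = (fps_exp (p - 1) * fps_sin q) / (1 - fps_X)"
    unfolding sine_derangement_gf_def
    using fps_exp_add_mult[of "-1" p]
    by (simp add: fps_divide_unit algebra_simps)
  then show ?thesis
    by (simp add: sine_derangement_def fps_divide_fps_X_minus1_sum atLeast0AtMost)
qed

theorem mainTheorem13:
  fixes M :: "'a measure" and X :: "'a \<Rightarrow> real" and p q :: real and n :: nat
  assumes "prob_space M"
    and "gamma_1_1_distributed M X"
  defines "Z \<equiv> \<lambda>\<omega>.
      ((complex_of_real (X \<omega>) - 1 + complex_of_real p + \<i> * complex_of_real q) ^ n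
       - (complex_of_real (X \<omega>) - 1 + complex_of_real p - \<i> * complex_of_real q) ^ n) / (2 * \<i>)"
  shows "integrable M Z \<and>
         prob_space.expectation M Z = complex_of_real (sine_derangement n p q)"
proof -
  define c where "c = complex_of_real (p - 1) + \<i> * complex_of_real q"
  define c' where "c' = complex_of_real (p - 1) - \<i> * complex_of_real q"
  have D: "distributed M lborel X (exponential_density 1)"
    using assms(2) by (simp add: gamma_1_1_distributed_def)
  have Z: "Z = (\<lambda>\<omega>. ((complex_of_real (X \<omega>) + c) ^ n - (complex_of_real (X \<omega>) + c') ^ n) / (2 * \<i>))"
    by (simp add: Z_def c_def c'_def algebra_simps)
  have "has_bochner_integral M Z
          ((fact n * (\<Sum>j\<le>n. c ^ j / fact j) - fact n * (\<Sum>j\<le>n. c' ^ j / fact j)) / (2 * \<i>))"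
    unfolding Z
    by (intro has_bochner_integral_divide has_bochner_integral_diff
          has_bochner_integral_exponential_shift_power assms(1) D)
  also have "(fact n * (\<Sum>j\<le>n. c ^ j / fact j) - fact n * (\<Sum>j\<le>n. c' ^ j / fact j)) / (2 * \<i>)
      = fact n * (\<Sum>j\<le>n. (c ^ j / fact j - c' ^ j / fact j) / (2 * \<i>))"
    by (simp only: sum_subtractf sum_divide_distrib[symmetric] right_diff_distrib times_divide_eq_right)
  also have "\<dots> = complex_of_real (sine_derangement n p q)"
    by (simp add: sine_derangement_eq_sum of_real_nth_fps_exp_mult_fps_sin c_def c'_def
          del: of_real_diff)
  finally show ?thesis
    by (simp add: has_bochner_integral_iff)
qed

end
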